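(* Let $K$ be a number field and $p$ a prime. Suppose $\varphi\in K[x]$ is post-critically finite, has degree $d$ divisible by $p$, and has good reduction at a valuation $v$ of $K$ of residue characteristic $p$, i.e. $\varphi$ has $v$-integral coefficients and $v$-unit leading coefficient. Then for every $t_0\in\mathcal O_K$ and every $n\ge1$, $$v\big(\mathrm{disc}_x(\varphi^{\circ n}(x)-t_0)\big)\ \ge\ n\,d^n\, v(p).$$
   Context: $\varphi^{\circ n}$ denotes the $n$-fold iterate of $\varphi$. The polynomial $\varphi$ is post-critically finite if every root in $\overline K$ of $\varphi'$ has finite forward orbit under iteration of $\varphi$. *)

theory Defs
  imports
    "HOL-Library.Extended_Real"
    "HOL-Computational_Algebra.Polynomial"
    "HOL-Algebra.Algebraic_Closure_Type"
    "Subresultants.Resultant_Prelim"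
begin

text \<open>A number field is modelled as a type: a field of characteristic 0 that is
  finite-dimensional as a vector space over the rationals.\<close>

definition number_field :: "'a :: field_char_0 itself \<Rightarrow> bool" where
  "number_field _ \<longleftrightarrow>
     (\<exists>B :: 'a set. finite B \<and> module.span (\<lambda>(q :: rat) x. of_rat q * x) B = UNIV)"

text \<open>Additive valuations of rank at most one. No normalisation is imposed, so both
  the normalisation with value group \<open>\<int>\<close> and the one with \<open>v p = 1\<close> are covered.\<close>

definition valuation :: "('a :: field \<Rightarrow> ereal) \<Rightarrow> bool" where
  "valuation v \<longleftrightarrow>
     (\<forall>x. v x \<noteq> -\<infinity>) \<and>
     (\<forall>x. v x = \<infinity> \<longleftrightarrow> x = 0) \<and>
     (\<forall>x y. v (x * y) = v x + v y) \<and>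
     (\<forall>x y. v (x + y) \<ge> min (v x) (v y))"

text \<open>The characteristic of the residue field \<open>{x. v x \<ge> 0} / {x. v x > 0}\<close>, in the same form
  as \<^const>\<open>semiring_char\<close>: \<open>of_nat n\<close> is zero in the residue field iff \<open>v (of_nat n) > 0\<close>.\<close>

definition residue_char :: "('a :: field \<Rightarrow> ereal) \<Rightarrow> nat" where
  "residue_char v = Gcd {n. v (of_nat n) > 0}"

definition good_reduction :: "('a :: field \<Rightarrow> ereal) \<Rightarrow> 'a poly \<Rightarrow> bool" where
  "good_reduction v f \<longleftrightarrow> (\<forall>i. v (coeff f i) \<ge> 0) \<and> v (lead_coeff f) = 0"

definition poly_iterate :: "'a :: comm_semiring_1 poly \<Rightarrow> nat \<Rightarrow> 'a poly" where
  "poly_iterate f n = (pcompose f ^^ n) [:0, 1:]"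

definition post_critically_finite :: "'a :: field poly \<Rightarrow> bool" where
  "post_critically_finite f \<longleftrightarrow>
     (\<forall>c :: 'a alg_closure. poly (map_poly to_ac (pderiv f)) c = 0 \<longrightarrow>
        finite (range (\<lambda>n. (poly (map_poly to_ac f) ^^ n) c)))"

text \<open>Meant for fields of characteristic 0, where \<open>pderiv f\<close> has degree \<open>degree f - 1\<close>, so that the
  Sylvester matrix has the expected size. The discriminant is normally only defined in
  positive degree; the value 1 for constants is the empty product of root differences.\<close>

definition discriminant :: "'a :: field_char_0 poly \<Rightarrow> 'a" where
  "discriminant f =
     (if degree f = 0 then 1
      else (-1) ^ (degree f * (degree f - 1) div 2) * resultant f (pderiv f) / lead_coeff f)"

end

theory Submission
  imports Defs "Subresultants.Subresultant"
begin

text \<open>By post-critical finiteness every critical point \<open>c\<close> satisfies \<open>\<phi>\<^sup>i(c) = \<phi>\<^sup>j(c)\<close> for some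
  \<open>i < j\<close>, hence is a root of a polynomial with \<open>v\<close>-integral coefficients and unit leading
  coefficient. By Gauss's lemma \<open>\<phi>' = d g\<close> with \<open>g\<close> integral, and by the chain rule
  \<open>(\<phi>\<^sup>n)' = d\<^sup>n G\<close> with \<open>G\<close> integral. The discriminant of \<open>F = \<phi>\<^sup>n - t\<^sub>0\<close> is a unit times
  \<open>Res(F, d\<^sup>n G)\<close>, where the scalar \<open>d\<^sup>n\<close> comes out to the power \<open>deg F = d\<^sup>n\<close>. No extension of
  \<open>v\<close> to the algebraic closure is needed.\<close>

section \<open>Iterates and minimal polynomials over the algebraic closure\<close>

interpretation to_ac: inj_idom_hom to_ac
  by unfold_locales auto

interpretation to_ac_poly: map_poly_inj_idom_hom to_ac ..

lemma poly_map_to_ac_pcompose: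
  "poly (map_poly to_ac (pcompose p q)) x = poly (map_poly to_ac p) (poly (map_poly to_ac q) x)"
  by (induction p) (auto simp: pcompose_pCons hom_distribs)

lemma poly_iterate_0: "poly_iterate f 0 = [:0, 1:]"
  by (simp add: poly_iterate_def)

lemma poly_iterate_Suc: "poly_iterate f (Suc n) = pcompose f (poly_iterate f n)"
  by (simp add: poly_iterate_def)

lemma poly_map_to_ac_iterate:
  "poly (map_poly to_ac (poly_iterate f n)) x = (poly (map_poly to_ac f) ^^ n) x"
  by (induction n) (simp_all add: poly_iterate_0 poly_iterate_Suc poly_map_to_ac_pcompose)

lemma degree_poly_iterate:
  fixes f :: "'a :: idom poly"
  shows "degree (poly_iterate f n) = degree f ^ n"
  by (induction n) (simp_all add: poly_iterate_0 poly_iterate_Suc degree_pcompose)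

text \<open>The polynomial \<open>P\<close> makes \<open>c\<close> algebraic. A nonzero annihilating
  polynomial of least degree, made monic, divides every other one because the remainder of the
  division also annihilates \<open>c\<close>.\<close>

lemma minimal_poly_exists:
  fixes c :: "'a :: field alg_closure" and P :: "'a poly"
  assumes "P \<noteq> 0" "poly (map_poly to_ac P) c = 0"
  obtains \<mu> where "lead_coeff \<mu> = 1" "poly (map_poly to_ac \<mu>) c = 0" "degree \<mu> > 0"
    "\<And>Q. poly (map_poly to_ac Q) c = 0 \<Longrightarrow> \<mu> dvd Q"
proof -
  define S where "S Q \<longleftrightarrow> Q \<noteq> 0 \<and> poly (map_poly to_ac Q) c = 0" for Q :: "'a poly"
  define \<mu>0 where "\<mu>0 = arg_min degree S"
  have "S P" using assms by (simp add: S_def)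
  have \<mu>0: "S \<mu>0" and min: "\<And>Q. S Q \<Longrightarrow> degree \<mu>0 \<le> degree Q"
    unfolding \<mu>0_def using arg_min_natI[of S P degree] arg_min_nat_le[of S _ degree] \<open>S P\<close> by auto
  define \<mu> where "\<mu> = smult (inverse (lead_coeff \<mu>0)) \<mu>0"
  have nz: "\<mu>0 \<noteq> 0" using \<mu>0 by (simp add: S_def)
  have lead: "lead_coeff \<mu> = 1" and deg: "degree \<mu> = degree \<mu>0" using nz by (simp_all add: \<mu>_def)
  have root: "poly (map_poly to_ac \<mu>) c = 0"
    using \<mu>0 by (simp add: \<mu>_def S_def hom_distribs)
  have dvd: "\<mu> dvd Q" if Q: "poly (map_poly to_ac Q) c = 0" for Q
  proof -
    have "map_poly to_ac (Q mod \<mu>) = map_poly to_ac (Q - \<mu> * (Q div \<mu>))"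
      by (simp add: minus_mult_div_eq_mod)
    hence "poly (map_poly to_ac (Q mod \<mu>)) c = 0"
      using Q root by (simp add: hom_distribs)
    moreover have "\<mu> \<noteq> 0" using lead by auto
    ultimately have "Q mod \<mu> = 0"
      using min[of "Q mod \<mu>"] degree_mod_less[of \<mu> Q] deg unfolding S_def by linarith
    thus ?thesis by (simp add: dvd_eq_mod_eq_0)
  qed
  have "degree \<mu> > 0"
  proof (rule ccontr)
    assume "\<not> degree \<mu> > 0"
    hence "\<mu> = 1" using lead by (metis degree_eq_zeroE gr0I coeff_pCons_0 degree_pCons_0 pCons_one)
    thus False using root by simp
  qed
  with that lead root dvd show ?thesis by blast
qed

section \<open>Arithmetic of valuations\<close>

context
  fixes v :: "'a :: field_char_0 \<Rightarrow> ereal"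
  assumes v: "valuation v"
begin

lemma v_mult: "v (x * y) = v x + v y"
  and v_add: "v (x + y) \<ge> min (v x) (v y)"
  and v_eq_PInfty_iff: "v x = \<infinity> \<longleftrightarrow> x = 0"
  and v_neq_MInfty: "v x \<noteq> -\<infinity>"
  using v by (auto simp: valuation_def)

lemma v_0 [simp]: "v 0 = \<infinity>"
  by (simp add: v_eq_PInfty_iff)

lemma v_finite:
  assumes "x \<noteq> 0"
  obtains r where "v x = ereal r"
  using assms v_eq_PInfty_iff[of x] v_neq_MInfty[of x] by (cases "v x") auto

lemma v_1 [simp]: "v 1 = 0"
proof -
  \<comment> \<open>Finiteness permits cancellation in \<open>v 1 = v 1 + v 1\<close>, an equation
    that \<open>\<infinity>\<close> would satisfy as well.\<close>
  obtain r where "v 1 = ereal r" by (rule v_finite[of 1]) auto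
  thus ?thesis using v_mult[of 1 1] by simp
qed

lemma v_minus [simp]: "v (- x) = v x"
proof -
  obtain r where r: "v (-1) = ereal r" by (rule v_finite[of "-1"]) auto
  hence "v (-1) = 0" using v_mult[of "-1" "-1"] by (simp add: zero_ereal_def)
  thus ?thesis using v_mult[of "-1" x] by simp
qed

lemma v_power: "x \<noteq> 0 \<Longrightarrow> v (x ^ k) = ereal (real k) * v x"
proof (induction k)
  case (Suc k)
  obtain r where "v x = ereal r" using Suc.prems by (rule v_finite)
  thus ?case using Suc by (simp add: v_mult algebra_simps)
qed (simp add: zero_ereal_def[symmetric])

lemma v_mult_nonneg: "v x \<ge> 0 \<Longrightarrow> v y \<ge> 0 \<Longrightarrow> v (x * y) \<ge> 0"
  by (simp add: v_mult)

lemma v_add_nonneg: "v x \<ge> 0 \<Longrightarrow> v y \<ge> 0 \<Longrightarrow> v (x + y) \<ge> 0"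
  using v_add[of x y] by (auto simp: min_def split: if_splits)

lemma v_diff_nonneg: "v x \<ge> 0 \<Longrightarrow> v y \<ge> 0 \<Longrightarrow> v (x - y) \<ge> 0"
  using v_add_nonneg[of x "- y"] by simp

lemma v_sum_nonneg: "(\<And>i. i \<in> A \<Longrightarrow> v (f i) \<ge> 0) \<Longrightarrow> v (sum f A) \<ge> 0"
  by (induction A rule: infinite_finite_induct) (auto intro: v_add_nonneg)

lemma v_prod_nonneg: "(\<And>i. i \<in> A \<Longrightarrow> v (f i) \<ge> 0) \<Longrightarrow> v (prod f A) \<ge> 0"
  by (induction A rule: infinite_finite_induct) (auto intro: v_mult_nonneg)

lemma v_of_nat_nonneg: "v (of_nat n) \<ge> 0"
  by (induction n) (auto intro: v_add_nonneg)

lemma v_of_int_nonneg: "v (of_int n) \<ge> 0"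
  by (cases n) (auto intro: v_of_nat_nonneg v_diff_nonneg simp del: of_nat_Suc)

text \<open>The hypothesis \<open>\<gamma> < \<infinity>\<close> covers the empty sum, whose
  valuation is \<open>\<infinity>\<close>.\<close>

lemma v_sum_gt:
  assumes "\<gamma> < \<infinity>" "\<And>i. i \<in> A \<Longrightarrow> v (f i) > \<gamma>"
  shows "v (sum f A) > \<gamma>"
  using assms
proof (induction A rule: infinite_finite_induct)
  case (insert x F)
  thus ?case using v_add[of "f x" "sum f F"] by (force simp: min_def split: if_splits)
qed auto

section \<open>Gauss's lemma and integrality from the roots\<close>

text \<open>Beyond the degree all valuations are \<open>\<infinity>\<close>, so the minimum is taken
  over finitely many indices. Choosing the least such index gives the strict inequality that singles
  out one term of a product coefficient.\<close>

lemma first_min_valuation_coeff: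
  assumes "A \<noteq> 0"
  obtains i where "coeff A i \<noteq> 0" "\<And>k. v (coeff A i) \<le> v (coeff A k)"
    "\<And>k. k < i \<Longrightarrow> v (coeff A i) < v (coeff A k)"
proof -
  define V where "V = (\<lambda>k. v (coeff A k)) ` {..degree A}"
  define \<alpha> where "\<alpha> = Min V"
  define i where "i = (LEAST k. v (coeff A k) = \<alpha>)"
  have V: "finite V" "V \<noteq> {}" by (auto simp: V_def)
  hence "\<exists>k. v (coeff A k) = \<alpha>" using Min_in[of V] unfolding \<alpha>_def[symmetric] by (auto simp: V_def)
  hence i: "v (coeff A i) = \<alpha>" unfolding i_def by (rule LeastI_ex)
  have le: "\<alpha> \<le> v (coeff A k)" for k
  proof (cases "k \<le> degree A")
    case True
    thus ?thesis using V by (auto simp: \<alpha>_def V_def intro!: Min_le)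
  qed (simp add: coeff_eq_0)
  have "\<alpha> < v (coeff A k)" if "k < i" for k
    using le[of k] not_less_Least[OF that[unfolded i_def]] by (auto simp: less_le)
  moreover have "coeff A i \<noteq> 0"
    using le[of "degree A"] i v_eq_PInfty_iff[of "lead_coeff A"] assms by auto
  ultimately show ?thesis using that[of i] i le by auto
qed

lemma good_reduction_mult:
  "good_reduction v A \<Longrightarrow> good_reduction v B \<Longrightarrow> good_reduction v (A * B)"
proof -
  assume "good_reduction v A" "good_reduction v B"
  moreover from this have "v (coeff (A * B) i) \<ge> 0" for i
    unfolding coeff_mult by (intro v_sum_nonneg v_mult_nonneg) (auto simp: good_reduction_def)
  ultimately show ?thesis by (simp add: good_reduction_def lead_coeff_mult v_mult)
qed

text \<open>Gauss's lemma: the first coefficients of minimal valuation in the two factors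
  produce a coefficient of the product whose valuation is the sum of the two minima.\<close>
lemma good_reduction_factor:
  assumes AB: "good_reduction v (A * B)" and lead: "v (lead_coeff A) = 0"
  shows "good_reduction v A"
proof -
  have leadB: "v (lead_coeff B) = 0"
    using AB lead by (simp add: good_reduction_def lead_coeff_mult v_mult)
  have nz: "A \<noteq> 0" "B \<noteq> 0" using lead leadB by auto
  obtain i where i: "coeff A i \<noteq> 0" "\<And>k. v (coeff A i) \<le> v (coeff A k)"
    "\<And>k. k < i \<Longrightarrow> v (coeff A i) < v (coeff A k)"
    using first_min_valuation_coeff[OF nz(1)] by blast
  obtain j where j: "coeff B j \<noteq> 0" "\<And>k. v (coeff B j) \<le> v (coeff B k)"
    "\<And>k. k < j \<Longrightarrow> v (coeff B j) < v (coeff B k)"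
    using first_min_valuation_coeff[OF nz(2)] by blast
  obtain \<alpha> where \<alpha>: "v (coeff A i) = ereal \<alpha>" using i(1) by (rule v_finite)
  obtain \<beta> where \<beta>: "v (coeff B j) = ereal \<beta>" using j(1) by (rule v_finite)
  \<comment> \<open>The unit leading coefficient of \<open>B\<close> bounds its minimum from above,
    so a negative \<open>\<alpha>\<close> forces \<open>\<alpha> + \<beta> < 0\<close>.\<close>
  have "\<beta> \<le> 0" using j(2)[of "degree B"] \<beta> leadB by simp
  have "\<alpha> \<ge> 0"
  proof (rule ccontr)
    assume "\<not> \<alpha> \<ge> 0"
    hence neg: "ereal (\<alpha> + \<beta>) < 0" using \<open>\<beta> \<le> 0\<close> by (simp add: zero_ereal_def)
    \<comment> \<open>\<open>R\<close> collects the other contributions to the coefficient of index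
      \<open>i + j\<close>. Each has \<open>k < i\<close> or \<open>i + j - k < j\<close>, so one of
      its two factors lies strictly above its minimum.\<close>
    define R where "R = (\<Sum>k\<in>{..i+j}-{i}. coeff A k * coeff B (i + j - k))"
    have "v (coeff A k * coeff B (i + j - k)) > ereal (\<alpha> + \<beta>)" if "k \<in> {..i+j}-{i}" for k
    proof (cases "k < i")
      case True
      have "ereal \<alpha> < v (coeff A k)" "ereal \<beta> \<le> v (coeff B (i + j - k))"
        using i(3)[OF True] j(2) \<alpha> \<beta> by auto
      thus ?thesis unfolding v_mult
        by (cases "v (coeff A k)"; cases "v (coeff B (i + j - k))") auto
    next
      case False
      hence "i + j - k < j" using that by auto
      hence "ereal \<alpha> \<le> v (coeff A k)" "ereal \<beta> < v (coeff B (i + j - k))"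
        using i(2) j(3) \<alpha> \<beta> by auto
      thus ?thesis unfolding v_mult
        by (cases "v (coeff A k)"; cases "v (coeff B (i + j - k))") auto
    qed
    hence "v R > ereal (\<alpha> + \<beta>)" unfolding R_def by (intro v_sum_gt) auto
    moreover have "v (coeff (A * B) (i + j)) > ereal (\<alpha> + \<beta>)"
      using AB less_le_trans[OF neg] by (simp add: good_reduction_def)
    moreover have "coeff (A * B) (i + j) = coeff A i * coeff B j + R"
      unfolding coeff_mult R_def by (subst sum.remove[of _ i]) auto
    \<comment> \<open>The isolated product is a difference of two elements of valuation above
      \<open>\<alpha> + \<beta>\<close>, yet its own valuation is exactly that sum.\<close>
    ultimately have "v (coeff A i * coeff B j) > ereal (\<alpha> + \<beta>)"
      using v_add[of "coeff (A * B) (i + j)" "- R"] by (auto simp: min_def split: if_splits)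
    thus False by (simp add: v_mult \<alpha> \<beta>)
  qed
  hence "v (coeff A k) \<ge> 0" for k
    using order_trans[OF _ i(2), of 0 k] \<alpha> by simp
  thus ?thesis using lead by (simp add: good_reduction_def)
qed

lemma good_reduction_dvd:
  "good_reduction v P \<Longrightarrow> A dvd P \<Longrightarrow> v (lead_coeff A) = 0 \<Longrightarrow> good_reduction v A"
  using good_reduction_factor by (auto elim!: dvdE)

text \<open>This replaces the argument by symmetric functions of integral roots. The minimal
  polynomial of a root divides both \<open>h\<close> and the given \<open>P\<close>, so Gauss's
  lemma gives it good reduction; the cofactor in \<open>h\<close> inherits both hypotheses in
  smaller degree.\<close>

lemma good_reduction_if_roots_integral:
  assumes "v (lead_coeff h) = 0"
    and "\<And>c. poly (map_poly to_ac h) c = 0 \<Longrightarrow>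
           \<exists>P. good_reduction v P \<and> poly (map_poly to_ac P) c = 0"
  shows "good_reduction v h"
  using assms
proof (induction "degree h" arbitrary: h rule: less_induct)
  case less
  have nz: "h \<noteq> 0" using less.prems(1) by auto
  show ?case
  proof (cases "degree h = 0")
    case True
    hence "v (coeff h i) \<ge> 0" for i using less.prems(1) by (cases "i = 0") (auto simp: coeff_eq_0)
    thus ?thesis using less.prems(1) by (simp add: good_reduction_def)
  next
    case False
    hence "degree (map_poly to_ac h) > 0" by simp
    then obtain c where c: "poly (map_poly to_ac h) c = 0"
      using alg_closed_imp_poly_has_root by blast
    obtain P where P: "good_reduction v P" "poly (map_poly to_ac P) c = 0"
      using less.prems(2)[OF c] by blast
    obtain \<mu> where \<mu>: "lead_coeff \<mu> = 1" "degree \<mu> > 0"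
      "\<And>Q. poly (map_poly to_ac Q) c = 0 \<Longrightarrow> \<mu> dvd Q"
      using minimal_poly_exists[OF nz c] by metis
    obtain q where q: "h = \<mu> * q" using \<mu>(3)[OF c] by (auto elim: dvdE)
    have "good_reduction v \<mu>"
      using good_reduction_dvd[OF P(1) \<mu>(3)[OF P(2)]] \<mu>(1) by simp
    moreover have "good_reduction v q"
    proof (rule less.hyps)
      show "degree q < degree h" using nz \<mu>(2) by (auto simp: q degree_mult_eq)
      show "v (lead_coeff q) = 0" using less.prems(1) \<mu>(1) by (simp add: q lead_coeff_mult)
    qed (use less.prems(2) in \<open>auto simp: q hom_distribs\<close>)
    ultimately show ?thesis unfolding q by (rule good_reduction_mult)
  qed
qed

text \<open>The linear polynomial with root \<open>t\<close> divides a monic polynomial with integer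
  coefficients, so Gauss's lemma makes its constant term \<open>- t\<close> integral.\<close>

lemma algebraic_int_imp_v_nonneg:
  assumes "algebraic_int t"
  shows "v t \<ge> 0"
proof -
  obtain P where P: "lead_coeff P = 1" "\<And>i. coeff P i \<in> \<int>" "poly P t = 0"
    using assms by (auto elim: algebraic_int.cases)
  have "good_reduction v P"
    using P(1,2) by (auto simp: good_reduction_def elim!: Ints_cases intro: v_of_int_nonneg)
      (metis Ints_cases v_of_int_nonneg)
  hence "good_reduction v [:-t, 1:]"
    by (rule good_reduction_dvd) (use P(3) in \<open>auto simp: poly_eq_0_iff_dvd\<close>)
  thus ?thesis by (auto simp: good_reduction_def dest!: spec[of _ 0])
qed

section \<open>Integrality of compositions, iterates and resultants\<close>

lemma v_coeff_pcompose_nonneg: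
  assumes "\<And>i. v (coeff p i) \<ge> 0" "\<And>i. v (coeff q i) \<ge> 0"
  shows "v (coeff (pcompose p q) i) \<ge> 0"
  using assms(1)
proof (induction p arbitrary: i)
  case (pCons a p)
  have "v (coeff [:a:] i) \<ge> 0" for i using pCons.prems[of 0] by (cases i) auto
  moreover have "v (coeff (pcompose p q) i) \<ge> 0" for i
    using pCons.IH pCons.prems[of "Suc _"] by simp
  ultimately show ?case
    unfolding pcompose_pCons coeff_add coeff_mult
    by (intro v_add_nonneg v_sum_nonneg v_mult_nonneg assms(2)) auto
qed simp

text \<open>Composition preserves integrality, and the leading coefficient is a product of units.
  Positive degree keeps the inner iterate nonconstant, as the formula for the leading coefficient
  requires.\<close>

lemma good_reduction_poly_iterate:
  assumes "good_reduction v f" "degree f > 0"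
  shows "good_reduction v (poly_iterate f n)"
proof (induction n)
  case 0
  show ?case by (auto simp: poly_iterate_0 good_reduction_def coeff_pCons split: nat.splits)
next
  case (Suc n)
  have "lead_coeff (poly_iterate f (Suc n)) =
      lead_coeff f * lead_coeff (poly_iterate f n) ^ degree f"
    unfolding poly_iterate_Suc using assms(2)
    by (intro lead_coeff_comp) (simp add: degree_poly_iterate)
  moreover have "lead_coeff (poly_iterate f n) \<noteq> 0" using Suc by (auto simp: good_reduction_def)
  ultimately show ?case
    using Suc assms v_coeff_pcompose_nonneg[of f "poly_iterate f n"]
    by (simp add: good_reduction_def poly_iterate_Suc v_mult v_power)
qed

text \<open>The resultant is the determinant of the Sylvester matrix, whose entries are zero or
  coefficients of \<open>p\<close> and \<open>q\<close>.\<close>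

lemma v_resultant_nonneg:
  assumes "\<And>i. v (coeff p i) \<ge> 0" "\<And>i. v (coeff q i) \<ge> 0"
  shows "v (resultant p q) \<ge> 0"
proof -
  have S: "v (sylvester_mat p q $$ (i, j)) \<ge> 0"
    if "i < degree p + degree q" "j < degree p + degree q" for i j
    using that assms by (simp add: sylvester_index_mat)
  have "v (signof \<pi>) \<ge> 0" for \<pi> :: "nat \<Rightarrow> nat" by (simp add: sign_def)
  thus ?thesis unfolding resultant_def det_def
    by (auto intro!: v_sum_nonneg v_mult_nonneg v_prod_nonneg S simp: permutes_in_image)
qed

lemma good_reduction_diff_lower_degree:
  assumes "good_reduction v f" "\<And>i. v (coeff g i) \<ge> 0" "degree g < degree f"
  shows "good_reduction v (f - g)"
proof -
  have "degree (f - g) = degree f" "lead_coeff (f - g) = lead_coeff f"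
    using assms(3) degree_add_eq_left[of "-g" f] by (simp_all add: coeff_eq_0)
  thus ?thesis using assms by (auto simp: good_reduction_def intro: v_diff_nonneg)
qed

section \<open>Derivatives of iterates and the discriminant bound\<close>

lemma pderiv_post_critically_finite:
  assumes good: "good_reduction v f" and pcf: "post_critically_finite f" and deg: "degree f > 1"
  obtains g where "pderiv f = smult (of_nat (degree f)) g" "\<And>i. v (coeff g i) \<ge> 0"
proof -
  define d where "d = degree f"
  define g where "g = smult (inverse (of_nat d)) (pderiv f)"
  have d: "(of_nat d :: 'a) \<noteq> 0" using deg by (simp add: d_def)
  \<comment> \<open>The leading coefficient of \<open>pderiv f\<close> is \<open>d\<close> times
    that of \<open>f\<close>, so dividing by \<open>d\<close> leaves a unit even if \<open>d\<close>
    has positive valuation.\<close>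
  have lead: "lead_coeff g = lead_coeff f"
    using d deg by (simp add: g_def degree_pderiv coeff_pderiv d_def[symmetric])
  have "good_reduction v g"
  proof (rule good_reduction_if_roots_integral)
    show "v (lead_coeff g) = 0" using good lead by (simp add: good_reduction_def)
    fix c assume "poly (map_poly to_ac g) c = 0"
    hence "poly (map_poly to_ac (pderiv f)) c = 0"
      using d by (simp add: g_def hom_distribs)
    hence fin: "finite (range (\<lambda>n. (poly (map_poly to_ac f) ^^ n) c))"
      using pcf by (simp add: post_critically_finite_def)
    have "\<not> inj (\<lambda>n. (poly (map_poly to_ac f) ^^ n) c)"
      using fin finite_imageD infinite_UNIV_nat by blast
    then obtain i j where ij: "i < j"
      "(poly (map_poly to_ac f) ^^ i) c = (poly (map_poly to_ac f) ^^ j) c"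
      by (metis (mono_tags, lifting) injI linorder_neqE_nat)
    \<comment> \<open>The collision of the orbit at times \<open>i < j\<close> makes
      \<open>c\<close> a root of \<open>P\<close>. Since the degree of \<open>f\<close> exceeds 1,
      the later iterate has the larger degree and supplies a unit leading coefficient.\<close>
    define P where "P = poly_iterate f j - poly_iterate f i"
    have "good_reduction v P" unfolding P_def
      using good_reduction_poly_iterate[OF good] deg ij(1)
      by (intro good_reduction_diff_lower_degree)
         (auto simp: degree_poly_iterate good_reduction_def)
    moreover have "poly (map_poly to_ac P) c = 0"
      using ij(2) by (simp add: P_def poly_map_to_ac_iterate hom_distribs)
    ultimately show "\<exists>P. good_reduction v P \<and> poly (map_poly to_ac P) c = 0" by blast
  qed
  thus ?thesis using d that[of g] by (auto simp: g_def d_def good_reduction_def)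
qed

text \<open>By the chain rule each further composition contributes one factor \<open>e\<close> and
  one integral cofactor.\<close>

lemma pderiv_poly_iterate:
  assumes good: "good_reduction v f" and deg: "degree f > 0"
    and g: "pderiv f = smult e g" "\<And>i. v (coeff g i) \<ge> 0"
  obtains G where "pderiv (poly_iterate f n) = smult (e ^ n) G" "\<And>i. v (coeff G i) \<ge> 0"
proof -
  have "\<exists>G. pderiv (poly_iterate f n) = smult (e ^ n) G \<and> (\<forall>i. v (coeff G i) \<ge> 0)"
  proof (induction n)
    case 0
    show ?case by (intro exI[of _ 1]) (auto simp: poly_iterate_0 pderiv_pCons)
  next
    case (Suc n)
    then obtain G where G: "pderiv (poly_iterate f n) = smult (e ^ n) G" "\<And>i. v (coeff G i) \<ge> 0"
      by blast
    have "v (coeff (poly_iterate f n) i) \<ge> 0" for i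
      using good_reduction_poly_iterate[OF good deg] by (simp add: good_reduction_def)
    hence "v (coeff (pcompose g (poly_iterate f n) * G) i) \<ge> 0" for i
      unfolding coeff_mult
      by (intro v_sum_nonneg v_mult_nonneg v_coeff_pcompose_nonneg g G)
    moreover have "pderiv (poly_iterate f (Suc n)) =
        smult (e ^ Suc n) (pcompose g (poly_iterate f n) * G)"
      by (simp add: poly_iterate_Suc pderiv_pcompose g(1) G(1) pcompose_smult mult.commute)
    ultimately show ?case by blast
  qed
  with that show ?thesis by blast
qed

text \<open>A scalar in the second argument of the resultant comes out to the power
  \<open>degree f\<close>. The sign and the leading coefficient are units, and the remaining
  resultant is integral.\<close>

lemma v_discriminant_ge:
  assumes good: "good_reduction v f" and deg: "degree f > 0"
    and G: "pderiv f = smult e G" "\<And>i. v (coeff G i) \<ge> 0" and e: "e \<noteq> 0"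
  shows "v (discriminant f) \<ge> ereal (real (degree f)) * v e"
proof -
  define s :: 'a where "s = (-1) ^ (degree f * (degree f - 1) div 2)"
  have lead: "v (lead_coeff f) = 0" using good by (simp add: good_reduction_def)
  hence nz: "lead_coeff f \<noteq> 0" by auto
  have "discriminant f * lead_coeff f = s * (e ^ degree f * resultant f G)"
    using deg e nz by (simp add: discriminant_def s_def G(1) resultant_smult_right)
  hence "v (discriminant f) = v s + (ereal (real (degree f)) * v e + v (resultant f G))"
    using v_mult[of "discriminant f" "lead_coeff f"] lead e by (simp add: v_mult v_power)
  moreover have "v s = 0" by (simp add: s_def v_power)
  moreover have "v (resultant f G) \<ge> 0"
    using good G(2) by (intro v_resultant_nonneg) (auto simp: good_reduction_def)
  ultimately show ?thesis by (simp add: ereal_le_add_self)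
qed

end

theorem theorem1p2:
  fixes \<phi> :: "'a :: field_char_0 poly" and v :: "'a \<Rightarrow> ereal"
    and p d n :: nat and t\<^sub>0 :: 'a
  assumes "number_field TYPE('a)"
    and "prime p"
    and "post_critically_finite \<phi>"
    and "degree \<phi> = d" and "p dvd d"
    and "valuation v" and "residue_char v = p"
    and "good_reduction v \<phi>"
    and "algebraic_int t\<^sub>0"
    and "n \<ge> 1"
  shows "v (discriminant (poly_iterate \<phi> n - [:t\<^sub>0:])) \<ge> ereal (real n * real d ^ n) * v (of_nat p)"
proof (cases "d = 0")
  \<comment> \<open>Divisibility by \<open>p\<close> allows \<open>d = 0\<close>. Then the
    discriminant is 1 by convention, with valuation 0, and \<open>n \<ge> 1\<close> makes
    \<open>d ^ n\<close>, hence the bound, vanish.\<close>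
  case True
  hence "degree (poly_iterate \<phi> n - [:t\<^sub>0:]) = 0"
    using degree_diff_le[of "poly_iterate \<phi> n" 0 "[:t\<^sub>0:]"] assms(4,10)
    by (simp add: degree_poly_iterate)
  thus ?thesis
    using True assms(10) v_1[OF assms(6)]
    by (simp add: discriminant_def power_0_left zero_ereal_def[symmetric])
next
  case False
  note v = assms(6)
  have "d > 1" using False assms(2,5) by (metis One_nat_def Suc_lessI not_prime_1 neq0_conv nat_dvd_1_iff_1)
  obtain g where g: "pderiv \<phi> = smult (of_nat d) g" "\<And>i. v (coeff g i) \<ge> 0"
    using pderiv_post_critically_finite[OF v assms(8,3)] \<open>d > 1\<close> assms(4) by auto
  obtain G where G: "pderiv (poly_iterate \<phi> n) = smult (of_nat d ^ n) G"
    "\<And>i. v (coeff G i) \<ge> 0"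
    using pderiv_poly_iterate[OF v assms(8) _ g] \<open>d > 1\<close> assms(4) by auto
  define F where "F = poly_iterate \<phi> n - [:t\<^sub>0:]"
  have deg: "degree (poly_iterate \<phi> n) = d ^ n" by (simp add: degree_poly_iterate assms(4))
  have "degree F = d ^ n"
    using degree_add_eq_left[of "-[:t\<^sub>0:]" "poly_iterate \<phi> n"] deg \<open>d > 1\<close>
    unfolding F_def diff_conv_add_uminus by simp
  have "good_reduction v F" unfolding F_def
    using \<open>d > 1\<close> assms(4,8) algebraic_int_imp_v_nonneg[OF v assms(9)] v_0[OF v]
    by (intro good_reduction_diff_lower_degree[OF v] good_reduction_poly_iterate[OF v])
      (auto simp: degree_poly_iterate coeff_pCons split: nat.splits)
  moreover have "pderiv F = smult (of_nat d ^ n) G" by (simp add: F_def pderiv_diff pderiv_pCons G)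
  ultimately have "v (discriminant F) \<ge> ereal (real (degree F)) * v (of_nat d ^ n)"
    using \<open>degree F = d ^ n\<close> \<open>d > 1\<close> G(2) by (intro v_discriminant_ge[OF v]) auto
  \<comment> \<open>Here \<open>d ^ n\<close> occurs twice: as the degree of \<open>F\<close>, and
    as the scalar inside \<open>v\<close>, whose exponent yields the factor
    \<open>n\<close>.\<close>
  also have "ereal (real (degree F)) * v (of_nat d ^ n) = ereal (real n * real d ^ n) * v (of_nat d)"
  proof -
    have nz: "of_nat d \<noteq> (0 :: 'a)" using \<open>d > 1\<close> by simp
    then obtain r where "v (of_nat d) = ereal r" by (rule v_finite[OF v])
    thus ?thesis using \<open>degree F = d ^ n\<close> by (simp add: v_power[OF v nz] algebra_simps)
  qed
  finally have le: "ereal (real n * real d ^ n) * v (of_nat d) \<le> v (discriminant F)" .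
  obtain k where k: "d = p * k" using assms(5) by (auto elim: dvdE)
  \<comment> \<open>The cofactor \<open>k\<close> has nonnegative valuation, so replacing
    \<open>d\<close> by \<open>p\<close> can only lower the bound.\<close>
  have "v (of_nat p) \<le> v (of_nat d)"
    using v_of_nat_nonneg[OF v, of k] by (simp add: k v_mult[OF v] ereal_le_add_self)
  hence "ereal (real n * real d ^ n) * v (of_nat p) \<le> ereal (real n * real d ^ n) * v (of_nat d)"
    by (intro ereal_mult_left_mono) auto
  with le show ?thesis unfolding F_def by order
qed

end
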